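(* Let $n\ge 2$ and let $C$ be a $(v,k,\lambda)$ projection $n$-cube with an autotopy group $G$ acting sharply transitively on each coordinate. Then there is an $n$-dimensional $(v,k,\lambda)$ difference set $D\subseteq G^n$ in $G$ such that $\overline{C}$ is equivalent to $\operatorname{dev} D$.
   Context: A symmetric $(v,k,\lambda)$ design is identified with its incidence matrix: it is a $v\times v$ matrix $A$ with entries in $\{0,1\}$ satisfying $AA^t=(k-\lambda)I+\lambda J$, where $I$ is the identity matrix and $J$ the all-ones matrix; as in the usual definition of symmetric block designs, every column of $A$ also contains exactly $k$ ones (this is automatic when $\lambda<k$). Let $\mathbb{F}$ be a field of characteristic $0$. For $C:\{1,\ldots,v\}^n\to\mathbb{F}$ and $1\le x<y\le n$, the projection $\Pi_{xy}(C)$ is the $v\times v$ matrix whose $(i_x,i_y)$-entry is the sum of $C(i_1,\ldots,i_n)$ over all $n$-tuples with the coordinates $i_x$ and $i_y$ fixed. A $(v,k,\lambda)$ projection $n$-cube is such a $C$ with entries in $\{0,1\}$ for which all $\Pi_{xy}(C)$, $1\le x<y\le n$, are symmetric $(v,k,\lambda)$ designs. It is identified with $\overline{C}=\{(i_1,\ldots,i_n)\mid C(i_1,\ldots,i_n)=1\}$. Cubes may be indexed by any set of size $v$, e.g. a group of order $v$, in place of $\{1,\ldots,v\}$. An autotopy of $C$ is an $n$-tuple $(\alpha_1,\ldots,\alpha_n)$ of permutations of the index set such that $\{(\alpha_1(i_1),\ldots,\alpha_n(i_n))\mid (i_1,\ldots,i_n)\in\overline{C}\}=\overline{C}$. All autotopies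 form a group $\operatorname{Atop}(C)$ under coordinatewise composition; an autotopy group of $C$ is a subgroup of it. An autotopy group $G$ acts sharply transitively on each coordinate if for every $j\in\{1,\ldots,n\}$ and all $a,b$ in the index set there is exactly one $(\alpha_1,\ldots,\alpha_n)\in G$ with $\alpha_j(a)=b$ (so $|G|=v$). Two cubes (identified with subsets $\overline{C}\subseteq X^n$, $\overline{C'}\subseteq Y^n$, where $X$, $Y$ are index sets of size $v$) are equivalent if there are a permutation $\gamma\in S_n$ of the order of the coordinates and bijections $\alpha_1,\ldots,\alpha_n:X\to Y$ such that permuting the coordinates of all tuples of $\overline{C}$ by $\gamma$ and then applying $\alpha_j$ to the $j$-th coordinate for each $j$ maps $\overline{C}$ onto $\overline{C'}$. Write the group $G$ additively (it need not be abelian). A $(v,k,\lambda)$ difference set in a group $G$ of order $v$ is a subset $E\subseteq G$ of size $k$ such that every $g\in G\setminus\{0\}$ can be written as $g=e_1-e_2$ for exactly $\lambda$ choices of $(e_1,e_2)\in E\times E$. An $n$-dimensional $(v,k,\lambda)$ difference set in $G$ is a set $D\subseteq G^n$ of size $k$ such that $\{d_x-d_y\mid d\in D\}\subseteq G$ is a $(v,k,\lambda)$ difference set in $G$ for all $1\le x<y\le n$. Its development is $\operatorname{dev} D=\{(d_1+g,\ldots,d_n+g)\mid g\in G,\ d\in D\}$. *)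

theory Defs
  imports
    "HOL-Algebra.Bij"
    "HOL-Algebra.Product_Groups"
    "HOL-Combinatorics.Permutations"
begin

text \<open>
  Index sets are finite sets \<open>X\<close>, and \<open>n\<close>-tuples over \<open>X\<close> are extensional functions on
  \<open>{1..n}\<close>. Matrices and cubes are functions of which only the values at indices in \<open>X\<close>,
  respectively at tuples over \<open>X\<close>, are used.
\<close>

abbreviation tuples :: "nat \<Rightarrow> 'a set \<Rightarrow> (nat \<Rightarrow> 'a) set" where
  "tuples n X \<equiv> {1..n} \<rightarrow>\<^sub>E X"

text \<open>The sum condition is \<open>A A\<^sup>t = (k - \<lambda>) I + \<lambda> J\<close>, with \<open>k - \<lambda>\<close> taken in the field.\<close>

definition symmetric_design ::
  "'a set \<Rightarrow> nat \<Rightarrow> nat \<Rightarrow> nat \<Rightarrow> ('a \<Rightarrow> 'a \<Rightarrow> 'f::field_char_0) \<Rightarrow> bool" where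
  "symmetric_design X v k l A \<longleftrightarrow>
     finite X \<and> card X = v \<and>
     (\<forall>a\<in>X. \<forall>b\<in>X. A a b \<in> {0, 1}) \<and>
     (\<forall>a\<in>X. \<forall>b\<in>X. (\<Sum>c\<in>X. A a c * A b c) =
        (of_nat k - of_nat l) * (if a = b then 1 else 0) + of_nat l * 1) \<and>
     (\<forall>b\<in>X. card {a\<in>X. A a b = 1} = k)"

definition projection ::
  "nat \<Rightarrow> 'a set \<Rightarrow> nat \<Rightarrow> nat \<Rightarrow> ((nat \<Rightarrow> 'a) \<Rightarrow> 'f::field_char_0) \<Rightarrow> 'a \<Rightarrow> 'a \<Rightarrow> 'f" where
  "projection n X x y C = (\<lambda>a b. \<Sum>i\<in>{i \<in> tuples n X. i x = a \<and> i y = b}. C i)"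

definition projection_cube ::
  "nat \<Rightarrow> 'a set \<Rightarrow> nat \<Rightarrow> nat \<Rightarrow> nat \<Rightarrow> ((nat \<Rightarrow> 'a) \<Rightarrow> 'f::field_char_0) \<Rightarrow> bool" where
  "projection_cube n X v k l C \<longleftrightarrow>
     finite X \<and> card X = v \<and>
     (\<forall>i\<in>tuples n X. C i \<in> {0, 1}) \<and>
     (\<forall>x y. 1 \<le> x \<and> x < y \<and> y \<le> n \<longrightarrow> symmetric_design X v k l (projection n X x y C))"

definition cube_set ::
  "nat \<Rightarrow> 'a set \<Rightarrow> ((nat \<Rightarrow> 'a) \<Rightarrow> 'f::field_char_0) \<Rightarrow> (nat \<Rightarrow> 'a) set" where
  "cube_set n X C = {i \<in> tuples n X. C i = 1}"

definition autotopies ::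
  "nat \<Rightarrow> 'a set \<Rightarrow> ((nat \<Rightarrow> 'a) \<Rightarrow> 'f::field_char_0) \<Rightarrow> (nat \<Rightarrow> 'a \<Rightarrow> 'a) set" where
  "autotopies n X C = {\<alpha> \<in> carrier (product_group {1..n} (\<lambda>_. BijGroup X)).
     (\<lambda>i. \<lambda>j\<in>{1..n}. \<alpha> j (i j)) ` cube_set n X C = cube_set n X C}"

definition Atop ::
  "nat \<Rightarrow> 'a set \<Rightarrow> ((nat \<Rightarrow> 'a) \<Rightarrow> 'f::field_char_0) \<Rightarrow> (nat \<Rightarrow> 'a \<Rightarrow> 'a) monoid" where
  "Atop n X C = (product_group {1..n} (\<lambda>_. BijGroup X))\<lparr>carrier := autotopies n X C\<rparr>"

definition sharply_transitive_on_coordinates ::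
  "nat \<Rightarrow> 'a set \<Rightarrow> (nat \<Rightarrow> 'a \<Rightarrow> 'a) set \<Rightarrow> bool" where
  "sharply_transitive_on_coordinates n X G \<longleftrightarrow>
     (\<forall>j\<in>{1..n}. \<forall>a\<in>X. \<forall>b\<in>X. \<exists>!\<alpha>. \<alpha> \<in> G \<and> \<alpha> j a = b)"

definition equivalent_cubes ::
  "nat \<Rightarrow> 'a set \<Rightarrow> (nat \<Rightarrow> 'a) set \<Rightarrow> 'b set \<Rightarrow> (nat \<Rightarrow> 'b) set \<Rightarrow> bool" where
  "equivalent_cubes n X S Y T \<longleftrightarrow>
     S \<subseteq> tuples n X \<and> T \<subseteq> tuples n Y \<and>
     (\<exists>\<gamma> \<alpha>. \<gamma> permutes {1..n} \<and> (\<forall>j\<in>{1..n}. bij_betw (\<alpha> j) X Y) \<and>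
        (\<lambda>i. \<lambda>j\<in>{1..n}. \<alpha> j (i (\<gamma> j))) ` S = T)"

text \<open>
  Groups are written multiplicatively: the additive \<open>a - b\<close> becomes \<open>a \<otimes> inv b\<close>, in this
  order, since the group need not be commutative.
\<close>

definition difference_set ::
  "('g, 'm) monoid_scheme \<Rightarrow> nat \<Rightarrow> nat \<Rightarrow> nat \<Rightarrow> 'g set \<Rightarrow> bool" where
  "difference_set G v k l E \<longleftrightarrow>
     group G \<and> finite (carrier G) \<and> order G = v \<and>
     E \<subseteq> carrier G \<and> card E = k \<and>
     (\<forall>g \<in> carrier G - {\<one>\<^bsub>G\<^esub>}.
        card {(e1, e2). e1 \<in> E \<and> e2 \<in> E \<and> g = e1 \<otimes>\<^bsub>G\<^esub> inv\<^bsub>G\<^esub> e2} = l)"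

definition difference_set_dim ::
  "nat \<Rightarrow> ('g, 'm) monoid_scheme \<Rightarrow> nat \<Rightarrow> nat \<Rightarrow> nat \<Rightarrow> (nat \<Rightarrow> 'g) set \<Rightarrow> bool" where
  "difference_set_dim n G v k l D \<longleftrightarrow>
     group G \<and> finite (carrier G) \<and> order G = v \<and>
     D \<subseteq> tuples n (carrier G) \<and> card D = k \<and>
     (\<forall>x y. 1 \<le> x \<and> x < y \<and> y \<le> n \<longrightarrow>
        difference_set G v k l {d x \<otimes>\<^bsub>G\<^esub> inv\<^bsub>G\<^esub> (d y) |d. d \<in> D})"

definition development ::
  "nat \<Rightarrow> ('g, 'm) monoid_scheme \<Rightarrow> (nat \<Rightarrow> 'g) set \<Rightarrow> (nat \<Rightarrow> 'g) set" where
  "development n G D = {(\<lambda>j\<in>{1..n}. d j \<otimes>\<^bsub>G\<^esub> g) |g d. g \<in> carrier G \<and> d \<in> D}"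

end

theory Submission
  imports Defs
begin

text \<open>
  A group acting sharply transitively on a set acts, in a suitable labelling of the set by the
  group elements, by right translation: fix a base point \<open>p\<close> and label \<open>x\<close> by the inverse of the
  unique element that takes \<open>p\<close> to \<open>x\<close>; then \<open>g\<close> acts as right multiplication by \<open>inv g\<close>
  (\<open>regular_action_as_right_translation\<close>). Doing this in each coordinate turns the cube into a set
  \<open>T\<close> of tuples over \<open>G\<close> that is invariant under \<open>(t\<^sub>1, \<dots>, t\<^sub>n) \<mapsto> (t\<^sub>1 g, \<dots>, t\<^sub>n g)\<close>. The
  coordinates keep their order, so the labelling alone is the required equivalence.

  Every translation orbit in \<open>T\<close> has exactly one member with first coordinate \<open>\<one>\<close>, so \<open>T\<close> is the
  development of the slice \<open>D\<close> of these members (\<open>development_of_slice\<close>). For \<open>x < y\<close> let \<open>E\<close> be the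
  set of quotients \<open>d\<^sub>x d\<^sub>y\<inverse>\<close>, \<open>d \<in> D\<close>. These quotients are constant on orbits, so the \<open>(a, b)\<close>
  entry of the projection to \<open>x, y\<close> is \<open>1\<close> exactly when \<open>a b\<inverse> \<in> E\<close>
  (\<open>quotient_mem_iff_shadow_development\<close>). Hence the scalar product of the rows \<open>g\<close> and \<open>\<one>\<close> is the
  number of ways to write \<open>g\<close> as a quotient of elements of \<open>E\<close> (\<open>card_quotient_pairs\<close>): the design
  equation for these two rows is the difference set condition at \<open>g\<close>. The sizes of \<open>E\<close> and \<open>D\<close> are
  both the row sum \<open>k\<close>, the latter because a tuple of \<open>T\<close> is determined by any two of its
  coordinates.
\<close>

section \<open>Projection cubes as sets of tuples\<close>

text \<open>
  The support of the projection to the coordinates \<open>x\<close> and \<open>y\<close>.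
\<close>

definition shadow :: "nat \<Rightarrow> nat \<Rightarrow> (nat \<Rightarrow> 'a) set \<Rightarrow> ('a \<times> 'a) set" where
  "shadow x y S = (\<lambda>i. (i x, i y)) ` S"

text \<open>
  The combinatorial content of a projection cube, without the field. Injectivity says that the
  projections have entries at most \<open>1\<close>; the cardinalities are the entries of \<open>A A\<^sup>t\<close>. In this form
  the property is carried along by relabellings of the index set.
\<close>

definition projects_to_designs ::
  "nat \<Rightarrow> 'a set \<Rightarrow> nat \<Rightarrow> nat \<Rightarrow> (nat \<Rightarrow> 'a) set \<Rightarrow> bool" where
  "projects_to_designs n X k l S \<longleftrightarrow>
     S \<subseteq> tuples n X \<and>
     (\<forall>x y. 1 \<le> x \<and> x < y \<and> y \<le> n \<longrightarrow>
        inj_on (\<lambda>i. (i x, i y)) S \<and>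
        (\<forall>a\<in>X. \<forall>b\<in>X. card {c\<in>X. (a, c) \<in> shadow x y S \<and> (b, c) \<in> shadow x y S} =
           (if a = b then k else l)))"

lemma projection_eq_card:
  assumes "finite X" and C01: "\<forall>i\<in>tuples n X. C i \<in> {0, 1}"
  shows "projection n X x y C a b = of_nat (card {i \<in> cube_set n X C. i x = a \<and> i y = b})"
proof -
  have fin: "finite {i \<in> tuples n X. i x = a \<and> i y = b}"
    using assms(1) by (simp add: finite_PiE)
  have "projection n X x y C a b
      = (\<Sum>i\<in>{i \<in> tuples n X. i x = a \<and> i y = b}. if C i = 1 then 1 else 0)"
    unfolding projection_def by (rule sum.cong) (use C01 in auto)
  also have "\<dots> = of_nat (card {i \<in> {i \<in> tuples n X. i x = a \<and> i y = b}. C i = 1})"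
    using fin by (simp add: sum.If_cases Int_def)
  also have "{i \<in> {i \<in> tuples n X. i x = a \<and> i y = b}. C i = 1}
      = {i \<in> cube_set n X C. i x = a \<and> i y = b}"
    by (auto simp: cube_set_def)
  finally show ?thesis .
qed

text \<open>
  Since the field has characteristic \<open>0\<close>, the matrix identities over it are identities between the
  counting numbers themselves.
\<close>

lemma projection_cube_projects_to_designs:
  fixes C :: "(nat \<Rightarrow> 'a) \<Rightarrow> 'f::field_char_0"
  assumes "projection_cube n X v k l C"
  shows "projects_to_designs n X k l (cube_set n X C)"
  unfolding projects_to_designs_def
proof (intro conjI allI impI)
  let ?S = "cube_set n X C"
  show S: "?S \<subseteq> tuples n X" by (auto simp: cube_set_def)
  have finX: "finite X" and C01: "\<forall>i\<in>tuples n X. C i \<in> {0, 1}"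
    using assms by (auto simp: projection_cube_def)
  have finS: "finite ?S" using S finX by (meson finite_PiE finite_atLeastAtMost finite_subset)
  fix x y assume xy: "1 \<le> x \<and> x < y \<and> y \<le> n"
  then have des: "symmetric_design X v k l (projection n X x y C)"
    using assms by (auto simp: projection_cube_def)
  have coord: "i x \<in> X" "i y \<in> X" if "i \<in> ?S" for i
    using that S xy by (auto simp: PiE_iff)
  have le1: "card {i \<in> ?S. i x = a \<and> i y = b} \<le> 1" if "a \<in> X" "b \<in> X" for a b
  proof -
    have "projection n X x y C a b \<in> {0, 1}"
      using des that by (auto simp: symmetric_design_def)
    then have "(of_nat (card {i \<in> ?S. i x = a \<and> i y = b}) :: 'f) \<in> {of_nat 0, of_nat 1}"
      by (simp add: projection_eq_card[OF finX C01])
    then show ?thesis unfolding insert_iff of_nat_eq_iff by auto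
  qed
  show inj: "inj_on (\<lambda>i. (i x, i y)) ?S"
  proof (rule inj_onI)
    fix i j assume ij: "i \<in> ?S" "j \<in> ?S" "(i x, i y) = (j x, j y)"
    then show "i = j"
      using le1[of "i x" "i y"] finS coord by (auto simp: card_le_Suc0_iff_eq)
  qed
  have entry: "projection n X x y C a b = (if (a, b) \<in> shadow x y ?S then 1 else 0)"
    if "a \<in> X" "b \<in> X" for a b
  proof (cases "(a, b) \<in> shadow x y ?S")
    case True
    then have "{i \<in> ?S. i x = a \<and> i y = b} \<noteq> {}" by (auto simp: shadow_def)
    then have "card {i \<in> ?S. i x = a \<and> i y = b} \<noteq> 0" using finS by simp
    then have "card {i \<in> ?S. i x = a \<and> i y = b} = 1" using le1[OF that] by linarith
    then show ?thesis using True by (simp add: projection_eq_card[OF finX C01])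
  next
    case False
    then have "{i \<in> ?S. i x = a \<and> i y = b} = {}" by (auto simp: shadow_def)
    then show ?thesis using False by (simp only: projection_eq_card[OF finX C01]) simp
  qed
  show "\<forall>a\<in>X. \<forall>b\<in>X. card {c\<in>X. (a, c) \<in> shadow x y ?S \<and> (b, c) \<in> shadow x y ?S} =
           (if a = b then k else l)"
  proof (intro ballI)
    fix a b assume ab: "a \<in> X" "b \<in> X"
    let ?K = "{c\<in>X. (a, c) \<in> shadow x y ?S \<and> (b, c) \<in> shadow x y ?S}"
    have "(of_nat (card ?K) :: 'f) = (\<Sum>c\<in>X. if c \<in> ?K then 1 else 0)"
      using finX by (simp add: sum.If_cases Int_def)
    also have "\<dots> = (\<Sum>c\<in>X. projection n X x y C a c * projection n X x y C b c)"
      by (rule sum.cong) (use ab in \<open>auto simp: entry\<close>)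
    also have "\<dots> = (of_nat k - of_nat l) * (if a = b then 1 else 0) + of_nat l * 1"
      using des ab unfolding symmetric_design_def by blast
    also have "\<dots> = of_nat (if a = b then k else l)" by simp
    finally show "card ?K = (if a = b then k else l)" by (simp only: of_nat_eq_iff)
  qed
qed

abbreviation relabel :: "nat \<Rightarrow> (nat \<Rightarrow> 'a \<Rightarrow> 'b) \<Rightarrow> (nat \<Rightarrow> 'a) \<Rightarrow> nat \<Rightarrow> 'b" where
  "relabel n \<psi> \<equiv> \<lambda>i. \<lambda>j\<in>{1..n}. \<psi> j (i j)"

lemma shadow_relabel:
  assumes "x \<in> {1..n}" "y \<in> {1..n}"
  shows "shadow x y (relabel n \<psi> ` S) = map_prod (\<psi> x) (\<psi> y) ` shadow x y S"
  using assms by (simp add: shadow_def image_image)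

lemma projects_to_designs_relabel:
  assumes S: "projects_to_designs n X k l S"
    and bij: "\<And>j. j \<in> {1..n} \<Longrightarrow> bij_betw (\<psi> j) X Y"
  shows "projects_to_designs n Y k l (relabel n \<psi> ` S)"
  unfolding projects_to_designs_def
proof (intro conjI allI impI)
  let ?r = "relabel n \<psi>"
  have sub: "S \<subseteq> tuples n X" using S by (simp add: projects_to_designs_def)
  show "?r ` S \<subseteq> tuples n Y"
    using sub bij by (fastforce simp: PiE_iff dest: bij_betwE)
  fix x y assume xy: "1 \<le> x \<and> x < y \<and> y \<le> n"
  then have x: "x \<in> {1..n}" and y: "y \<in> {1..n}" by auto
  have inj: "inj_on (\<lambda>i. (i x, i y)) S" using S xy by (simp add: projects_to_designs_def)
  have coord: "i x \<in> X" "i y \<in> X" if "i \<in> S" for i using that sub x y by (auto simp: PiE_iff)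
  have injx: "inj_on (\<psi> x) X" and injy: "inj_on (\<psi> y) X"
    using bij x y by (auto simp: bij_betw_def)
  show "inj_on (\<lambda>i. (i x, i y)) (?r ` S)"
  proof (rule inj_onI)
    fix s t assume "s \<in> ?r ` S" "t \<in> ?r ` S" and eq: "(s x, s y) = (t x, t y)"
    then obtain i j where ij: "i \<in> S" "j \<in> S" "s = ?r i" "t = ?r j" by auto
    with eq x y have "\<psi> x (i x) = \<psi> x (j x)" "\<psi> y (i y) = \<psi> y (j y)" by auto
    then have "i x = j x" "i y = j y" using coord ij injx injy by (auto dest: inj_onD)
    then show "s = t" using inj ij by (auto dest: inj_onD)
  qed
  have shadowX: "p \<in> X" "q \<in> X" if "(p, q) \<in> shadow x y S" for p q
    using that coord by (auto simp: shadow_def)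
  have mem: "(\<psi> x p, \<psi> y q) \<in> shadow x y (?r ` S) \<longleftrightarrow> (p, q) \<in> shadow x y S"
    if "p \<in> X" "q \<in> X" for p q
  proof
    assume "(\<psi> x p, \<psi> y q) \<in> shadow x y (?r ` S)"
    then obtain p' q' where "(p', q') \<in> shadow x y S" "\<psi> x p = \<psi> x p'" "\<psi> y q = \<psi> y q'"
      unfolding shadow_relabel[OF x y] by auto
    then show "(p, q) \<in> shadow x y S" using that injx injy shadowX by (metis inj_onD)
  next
    assume "(p, q) \<in> shadow x y S"
    then show "(\<psi> x p, \<psi> y q) \<in> shadow x y (?r ` S)"
      unfolding shadow_relabel[OF x y] by (rule rev_image_eqI) simp
  qed
  show "\<forall>a\<in>Y. \<forall>b\<in>Y. card {c\<in>Y. (a, c) \<in> shadow x y (?r ` S) \<and> (b, c) \<in> shadow x y (?r ` S)} =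
           (if a = b then k else l)"
  proof (intro ballI)
    fix a b assume "a \<in> Y" "b \<in> Y"
    then obtain p q where pq: "p \<in> X" "q \<in> X" "a = \<psi> x p" "b = \<psi> x q"
      using bij[OF x] by (auto simp: bij_betw_def)
    have "{c\<in>Y. (a, c) \<in> shadow x y (?r ` S) \<and> (b, c) \<in> shadow x y (?r ` S)}
        = \<psi> y ` {c\<in>X. (p, c) \<in> shadow x y S \<and> (q, c) \<in> shadow x y S}"
      using bij[OF y] mem pq by (auto simp: bij_betw_def)
    then have "card {c\<in>Y. (a, c) \<in> shadow x y (?r ` S) \<and> (b, c) \<in> shadow x y (?r ` S)}
        = card {c\<in>X. (p, c) \<in> shadow x y S \<and> (q, c) \<in> shadow x y S}"
      using injy by (simp add: card_image inj_on_def)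
    also have "\<dots> = (if p = q then k else l)"
      using S xy pq by (simp add: projects_to_designs_def)
    also have "p = q \<longleftrightarrow> a = b" using pq injx by (auto dest: inj_onD)
    finally show "card {c\<in>Y. (a, c) \<in> shadow x y (?r ` S) \<and> (b, c) \<in> shadow x y (?r ` S)} =
           (if a = b then k else l)" .
  qed
qed

section \<open>Translation-invariant sets of tuples over a group\<close>

context group
begin

text \<open>
  Translating \<open>t\<close> by \<open>inv (t 1)\<close> is the only way to move it into the slice.
\<close>

lemma development_of_slice:
  assumes "1 \<le> n" and T: "T \<subseteq> tuples n (carrier G)"
    and transl: "\<And>t g. t \<in> T \<Longrightarrow> g \<in> carrier G \<Longrightarrow> (\<lambda>j\<in>{1..n}. t j \<otimes> g) \<in> T"
  shows "development n G {t \<in> T. t 1 = \<one>} = T"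
proof
  show "development n G {t \<in> T. t 1 = \<one>} \<subseteq> T"
    using transl by (auto simp: development_def)
  show "T \<subseteq> development n G {t \<in> T. t 1 = \<one>}"
  proof
    fix t assume t: "t \<in> T"
    then have tj: "t j \<in> carrier G" if "j \<in> {1..n}" for j using T that by (auto simp: PiE_iff)
    have t1: "t 1 \<in> carrier G" using tj \<open>1 \<le> n\<close> by simp
    define d where "d = (\<lambda>j\<in>{1..n}. t j \<otimes> inv (t 1))"
    have "d \<in> T" unfolding d_def using transl[OF t] t1 by simp
    moreover have "d 1 = \<one>" using t1 \<open>1 \<le> n\<close> by (simp add: d_def)
    moreover have "t = (\<lambda>j\<in>{1..n}. d j \<otimes> t 1)"
    proof (rule extensionalityI)
      show "t \<in> extensional {1..n}" using t T by (auto simp: PiE_iff)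
      show "t j = (\<lambda>j\<in>{1..n}. d j \<otimes> t 1) j" if "j \<in> {1..n}" for j
        using that tj[OF that] t1 by (simp add: d_def m_assoc)
    qed auto
    ultimately show "t \<in> development n G {t \<in> T. t 1 = \<one>}"
      using t1 unfolding development_def by blast
  qed
qed

text \<open>
  Translation by \<open>g\<close> cancels in \<open>(d x g) (d y g)\<inverse>\<close>, so each projection of a development depends
  only on the quotient of its two indices.
\<close>

lemma quotient_mem_iff_shadow_development:
  assumes D: "D \<subseteq> tuples n (carrier G)" and x: "x \<in> {1..n}" and y: "y \<in> {1..n}"
    and a: "a \<in> carrier G" and b: "b \<in> carrier G"
  shows "a \<otimes> inv b \<in> {d x \<otimes> inv (d y) |d. d \<in> D} \<longleftrightarrow> (a, b) \<in> shadow x y (development n G D)"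
proof
  have cl: "d x \<in> carrier G" "d y \<in> carrier G" if "d \<in> D" for d
    using that D x y by (auto simp: PiE_iff)
  show "(a, b) \<in> shadow x y (development n G D)"
    if q: "a \<otimes> inv b \<in> {d x \<otimes> inv (d y) |d. d \<in> D}"
  proof -
    obtain d where d: "d \<in> D" and eq: "a \<otimes> inv b = d x \<otimes> inv (d y)" using q by blast
    \<comment> \<open>The translate of \<open>d\<close> whose coordinate \<open>y\<close> is \<open>b\<close>; its coordinate \<open>x\<close> is then forced.\<close>
    let ?t = "\<lambda>j\<in>{1..n}. d j \<otimes> (inv (d y) \<otimes> b)"
    have "?t \<in> development n G D" using d cl b unfolding development_def by blast
    moreover have "?t y = b" using y cl[OF d] b by (simp add: m_assoc[symmetric])
    moreover have "?t x = a"
    proof -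
      have "?t x = d x \<otimes> inv (d y) \<otimes> b" using x cl[OF d] b by (simp add: m_assoc)
      also have "\<dots> = a \<otimes> inv b \<otimes> b" by (simp only: eq)
      also have "\<dots> = a" using a b by (simp add: m_assoc)
      finally show ?thesis .
    qed
    ultimately show ?thesis unfolding shadow_def image_iff by metis
  qed
  show "a \<otimes> inv b \<in> {d x \<otimes> inv (d y) |d. d \<in> D}"
    if s: "(a, b) \<in> shadow x y (development n G D)"
  proof -
    obtain d g where d: "d \<in> D" and g: "g \<in> carrier G" and ab: "a = d x \<otimes> g" "b = d y \<otimes> g"
      using s x y by (auto simp: shadow_def development_def)
    have "a \<otimes> inv b = d x \<otimes> (g \<otimes> inv g) \<otimes> inv (d y)"
      unfolding ab using cl[OF d] g by (simp only: inv_mult_group m_assoc m_closed inv_closed)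
    also have "\<dots> = d x \<otimes> inv (d y)" using cl[OF d] g by simp
    finally show ?thesis using d by blast
  qed
qed

text \<open>
  A pair \<open>(e1, e2)\<close> with quotient \<open>g\<close> is determined by \<open>e2\<close>, and \<open>c = inv e2\<close> is a common column
  of the rows \<open>g\<close> and \<open>\<one>\<close> of the matrix whose \<open>(a, b)\<close> entry tells whether \<open>a \<otimes> inv b \<in> E\<close>. The
  factor \<open>\<one>\<close> is kept so that both conditions have this shape.
\<close>

lemma card_quotient_pairs:
  assumes E: "E \<subseteq> carrier G" and g: "g \<in> carrier G"
  shows "card {(e1, e2). e1 \<in> E \<and> e2 \<in> E \<and> g = e1 \<otimes> inv e2}
       = card {c \<in> carrier G. g \<otimes> inv c \<in> E \<and> \<one> \<otimes> inv c \<in> E}"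
proof (rule bij_betw_same_card[symmetric])
  show "bij_betw (\<lambda>c. (g \<otimes> inv c, inv c))
          {c \<in> carrier G. g \<otimes> inv c \<in> E \<and> \<one> \<otimes> inv c \<in> E}
          {(e1, e2). e1 \<in> E \<and> e2 \<in> E \<and> g = e1 \<otimes> inv e2}"
  proof (rule bij_betw_byWitness[where f' = "\<lambda>(e1, e2). inv e2"])
    show "\<forall>e\<in>{(e1, e2). e1 \<in> E \<and> e2 \<in> E \<and> g = e1 \<otimes> inv e2}.
        (\<lambda>c. (g \<otimes> inv c, inv c)) ((\<lambda>(e1, e2). inv e2) e) = e"
      using E by (auto simp: m_assoc subset_iff)
  qed (use E g in \<open>auto simp: m_assoc subset_iff\<close>)
qed

text \<open>
  Both sizes are row sums of a projection: \<open>D\<close> corresponds to the row \<open>\<one>\<close> of the projection to the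
  first two coordinates, and inversion takes the quotient set \<open>E\<close> to the row \<open>\<one>\<close> of the projection
  to \<open>x, y\<close>. The design condition then only has to be read off for the rows \<open>g\<close> and \<open>\<one>\<close>.
\<close>

theorem slice_is_difference_set_dim:
  assumes "2 \<le> n" and fin: "finite (carrier G)"
    and T: "projects_to_designs n (carrier G) k l T"
    and transl: "\<And>t g. t \<in> T \<Longrightarrow> g \<in> carrier G \<Longrightarrow> (\<lambda>j\<in>{1..n}. t j \<otimes> g) \<in> T"
  shows "difference_set_dim n G (order G) k l {t \<in> T. t 1 = \<one>}"
proof -
  define D where "D = {t \<in> T. t 1 = \<one>}"
  have Tsub: "T \<subseteq> tuples n (carrier G)" using T by (simp add: projects_to_designs_def)
  then have Dsub: "D \<subseteq> tuples n (carrier G)" by (auto simp: D_def)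
  have dev: "development n G D = T"
    unfolding D_def using \<open>2 \<le> n\<close> Tsub transl by (intro development_of_slice) auto
  have inj: "inj_on (\<lambda>t. (t x, t y)) T" if "1 \<le> x \<and> x < y \<and> y \<le> n" for x y
    using T that by (simp add: projects_to_designs_def)
  have sh: "card {c \<in> carrier G. (a, c) \<in> shadow x y T \<and> (b, c) \<in> shadow x y T} =
      (if a = b then k else l)"
    if "1 \<le> x \<and> x < y \<and> y \<le> n" "a \<in> carrier G" "b \<in> carrier G" for x y a b
    using T that by (simp add: projects_to_designs_def)
  have cardD: "card D = k"
  proof -
    have 12: "1 \<le> (1::nat) \<and> 1 < (2::nat) \<and> 2 \<le> n" using \<open>2 \<le> n\<close> by simp
    have "(\<lambda>t. t 2) ` D = {c \<in> carrier G. (\<one>, c) \<in> shadow 1 2 T \<and> (\<one>, c) \<in> shadow 1 2 T}"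
    proof
      have "t 2 \<in> carrier G" if "t \<in> T" for t
        using that Tsub \<open>2 \<le> n\<close> by (auto simp: PiE_iff)
      moreover have "(\<one>, t 2) \<in> shadow 1 2 T" if "t \<in> T" "t 1 = \<one>" for t
        unfolding shadow_def using that by (metis (mono_tags) image_eqI)
      ultimately show "(\<lambda>t. t 2) ` D
          \<subseteq> {c \<in> carrier G. (\<one>, c) \<in> shadow 1 2 T \<and> (\<one>, c) \<in> shadow 1 2 T}"
        by (auto simp: D_def)
      show "{c \<in> carrier G. (\<one>, c) \<in> shadow 1 2 T \<and> (\<one>, c) \<in> shadow 1 2 T} \<subseteq> (\<lambda>t. t 2) ` D"
        by (auto simp: D_def shadow_def)
    qed
    moreover have "inj_on (\<lambda>t. t 2) D"
      using inj[OF 12] by (auto simp: D_def inj_on_def)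
    ultimately show ?thesis using sh[OF 12, of \<one> \<one>] by (metis card_image one_closed)
  qed
  have "difference_set G (order G) k l {d x \<otimes> inv (d y) |d. d \<in> D}"
    if xy: "1 \<le> x \<and> x < y \<and> y \<le> n" for x y
  proof -
    define E where "E = {d x \<otimes> inv (d y) |d. d \<in> D}"
    have x: "x \<in> {1..n}" and y: "y \<in> {1..n}" using xy by auto
    have cl: "d j \<in> carrier G" if "d \<in> D" "j \<in> {1..n}" for d j
      using that Dsub by (auto simp: PiE_iff)
    have Esub: "E \<subseteq> carrier G" using cl x y by (auto simp: E_def)
    have mem: "a \<otimes> inv b \<in> E \<longleftrightarrow> (a, b) \<in> shadow x y T"
      if "a \<in> carrier G" "b \<in> carrier G" for a b
      using quotient_mem_iff_shadow_development[OF Dsub x y that] by (simp add: E_def dev)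
    have "card E = card {c \<in> carrier G. \<one> \<otimes> inv c \<in> E}"
    proof (rule bij_betw_same_card)
      show "bij_betw (\<lambda>e. inv e) E {c \<in> carrier G. \<one> \<otimes> inv c \<in> E}"
        by (rule bij_betw_byWitness[where f' = "\<lambda>c. inv c"]) (use Esub in auto)
    qed
    also have "{c \<in> carrier G. \<one> \<otimes> inv c \<in> E}
        = {c \<in> carrier G. (\<one>, c) \<in> shadow x y T \<and> (\<one>, c) \<in> shadow x y T}"
      using mem[OF one_closed] by blast
    also have "card \<dots> = k" using sh[OF xy one_closed one_closed] by simp
    finally have cardE: "card E = k" .
    have "card {(e1, e2). e1 \<in> E \<and> e2 \<in> E \<and> g = e1 \<otimes> inv e2} = l"
      if g: "g \<in> carrier G - {\<one>}" for g
    proof -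
      have gc: "g \<in> carrier G" using g by simp
      have "{c \<in> carrier G. g \<otimes> inv c \<in> E \<and> \<one> \<otimes> inv c \<in> E}
          = {c \<in> carrier G. (g, c) \<in> shadow x y T \<and> (\<one>, c) \<in> shadow x y T}"
        using mem[OF one_closed] mem[OF gc] by blast
      then show ?thesis
        using sh[OF xy gc one_closed] g by (simp add: card_quotient_pairs[OF Esub gc])
    qed
    then show ?thesis
      using fin Esub cardE is_group unfolding difference_set_def E_def by blast
  qed
  then show ?thesis
    using fin Dsub cardD is_group unfolding difference_set_dim_def D_def by blast
qed

end

section \<open>Sharply transitive actions and autotopies\<close>

text \<open>
  The orbit map \<open>a \<mapsto> act a p\<close> would turn the action into left translation. Developments are formed by
  right translation, so it is composed with inversion: for \<open>\<rho> a = act (inv a) p\<close> one gets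
  \<open>\<rho> (a \<otimes> g) = act (inv g) (\<rho> a)\<close>, and \<open>\<psi>\<close> is the inverse of the bijection \<open>\<rho>\<close>.
\<close>

lemma (in group) regular_action_as_right_translation:
  assumes closed: "\<And>a x. a \<in> carrier G \<Longrightarrow> x \<in> X \<Longrightarrow> act a x \<in> X"
    and act_mult: "\<And>a b x. a \<in> carrier G \<Longrightarrow> b \<in> carrier G \<Longrightarrow> x \<in> X \<Longrightarrow>
                     act (a \<otimes> b) x = act a (act b x)"
    and p: "p \<in> X"
    and regular: "\<And>x. x \<in> X \<Longrightarrow> \<exists>!a. a \<in> carrier G \<and> act a p = x"
  obtains \<psi> where "bij_betw \<psi> X (carrier G)"
    and "\<And>x g. x \<in> X \<Longrightarrow> g \<in> carrier G \<Longrightarrow> \<psi> x \<otimes> g = \<psi> (act (inv g) x)"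
proof -
  define \<rho> where "\<rho> a = act (inv a) p" for a
  have bij_\<rho>: "bij_betw \<rho> (carrier G) X"
    unfolding bij_betw_def
  proof
    show "inj_on \<rho> (carrier G)"
    proof (rule inj_onI)
      fix a b assume ab: "a \<in> carrier G" "b \<in> carrier G" "\<rho> a = \<rho> b"
      then have "inv a = inv b"
        using regular[OF closed[OF inv_closed[OF ab(1)] p]] by (auto simp: \<rho>_def)
      then show "a = b" using ab by (metis inv_inv)
    qed
    show "\<rho> ` carrier G = X"
    proof
      show "\<rho> ` carrier G \<subseteq> X" using closed p by (auto simp: \<rho>_def)
      show "X \<subseteq> \<rho> ` carrier G"
      proof
        fix x assume "x \<in> X"
        then obtain a where "a \<in> carrier G" "act a p = x" using regular by blast
        then have "x = \<rho> (inv a)" "inv a \<in> carrier G" by (auto simp: \<rho>_def)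
        then show "x \<in> \<rho> ` carrier G" by blast
      qed
    qed
  qed
  define \<psi> where "\<psi> = the_inv_into (carrier G) \<rho>"
  have bij: "bij_betw \<psi> X (carrier G)"
    unfolding \<psi>_def by (rule bij_betw_the_inv_into[OF bij_\<rho>])
  have \<rho>\<psi>: "\<rho> (\<psi> x) = x" if "x \<in> X" for x
    unfolding \<psi>_def by (rule f_the_inv_into_f_bij_betw[OF bij_\<rho>]) (use that in simp)
  have \<psi>\<rho>: "\<psi> (\<rho> a) = a" if "a \<in> carrier G" for a
    unfolding \<psi>_def using that bij_\<rho> by (auto intro: the_inv_into_f_f simp: bij_betw_def)
  have "\<psi> x \<otimes> g = \<psi> (act (inv g) x)" if x: "x \<in> X" and g: "g \<in> carrier G" for x g
  proof -
    have c: "\<psi> x \<in> carrier G" using bij x by (auto dest: bij_betwE)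
    have "\<rho> (\<psi> x \<otimes> g) = act (inv g) (\<rho> (\<psi> x))"
      unfolding \<rho>_def using c g p by (simp add: inv_mult_group act_mult)
    then show ?thesis using \<psi>\<rho>[of "\<psi> x \<otimes> g"] \<rho>\<psi>[OF x] c g by simp
  qed
  with bij that show ?thesis by blast
qed

abbreviation bij_tuples :: "nat \<Rightarrow> 'a set \<Rightarrow> (nat \<Rightarrow> 'a \<Rightarrow> 'a) monoid" where
  "bij_tuples n X \<equiv> product_group {1..n} (\<lambda>_. BijGroup X)"

lemma bij_tuples_bij:
  "\<alpha> \<in> carrier (bij_tuples n X) \<Longrightarrow> j \<in> {1..n} \<Longrightarrow> bij_betw (\<alpha> j) X X"
  by (auto simp: PiE_iff BijGroup_def Bij_def)

lemma bij_tuples_mult_apply: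
  assumes "\<alpha> \<in> carrier (bij_tuples n X)" "\<beta> \<in> carrier (bij_tuples n X)" "j \<in> {1..n}" "x \<in> X"
  shows "(\<alpha> \<otimes>\<^bsub>bij_tuples n X\<^esub> \<beta>) j x = \<alpha> j (\<beta> j x)"
proof -
  have "\<alpha> j \<in> Bij X" "\<beta> j \<in> Bij X" using assms by (auto simp: PiE_iff BijGroup_def)
  then show ?thesis using assms(3,4) by (simp add: BijGroup_def compose_eq)
qed

lemma relabel_mult:
  assumes \<alpha>: "\<alpha> \<in> carrier (bij_tuples n X)" and \<beta>: "\<beta> \<in> carrier (bij_tuples n X)"
    and S: "S \<subseteq> tuples n X"
  shows "relabel n (\<alpha> \<otimes>\<^bsub>bij_tuples n X\<^esub> \<beta>) ` S = relabel n \<alpha> ` relabel n \<beta> ` S"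
  unfolding image_image
proof (rule image_cong[OF refl])
  fix i assume "i \<in> S"
  then have "i j \<in> X" if "j \<in> {1..n}" for j using S that by (auto simp: PiE_iff)
  then show "relabel n (\<alpha> \<otimes>\<^bsub>bij_tuples n X\<^esub> \<beta>) i = relabel n \<alpha> (relabel n \<beta> i)"
    by (intro restrict_ext) (simp only: restrict_apply' bij_tuples_mult_apply[OF \<alpha> \<beta>])
qed

lemma relabel_one:
  assumes "S \<subseteq> tuples n X"
  shows "relabel n \<one>\<^bsub>bij_tuples n X\<^esub> ` S = S"
proof -
  have "relabel n \<one>\<^bsub>bij_tuples n X\<^esub> i = i" if "i \<in> S" for i
  proof (rule extensionalityI)
    show "i \<in> extensional {1..n}" using that assms by (auto simp: PiE_iff)
    show "relabel n \<one>\<^bsub>bij_tuples n X\<^esub> i j = i j" if "j \<in> {1..n}" for j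
      using that \<open>i \<in> S\<close> assms by (auto simp: BijGroup_def PiE_iff)
  qed auto
  then show ?thesis by simp
qed

lemma group_bij_tuples: "group (bij_tuples n X)"
  by (simp add: group_BijGroup)

lemma group_Atop: "group (Atop n X C)"
  unfolding Atop_def
proof (intro group.subgroup_imp_group[OF group_bij_tuples]
    group.subgroupI[OF group_bij_tuples])
  let ?P = "bij_tuples n X" and ?S = "cube_set n X C"
  interpret P: group ?P by (rule group_bij_tuples)
  have S: "?S \<subseteq> tuples n X" by (auto simp: cube_set_def)
  show "autotopies n X C \<subseteq> carrier ?P" unfolding autotopies_def by blast
  show "autotopies n X C \<noteq> {}"
    using relabel_one[OF S] P.one_closed unfolding autotopies_def by blast
  fix \<alpha> assume "\<alpha> \<in> autotopies n X C"
  then have \<alpha>: "\<alpha> \<in> carrier ?P" and \<alpha>S: "relabel n \<alpha> ` ?S = ?S"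
    unfolding autotopies_def by blast+
  have "relabel n (inv\<^bsub>?P\<^esub> \<alpha>) ` ?S = relabel n (inv\<^bsub>?P\<^esub> \<alpha>) ` relabel n \<alpha> ` ?S"
    by (simp only: \<alpha>S)
  also have "\<dots> = relabel n (inv\<^bsub>?P\<^esub> \<alpha> \<otimes>\<^bsub>?P\<^esub> \<alpha>) ` ?S"
    by (rule relabel_mult[OF P.inv_closed[OF \<alpha>] \<alpha> S, symmetric])
  also have "\<dots> = ?S" by (simp only: P.l_inv[OF \<alpha>] relabel_one[OF S])
  finally show "inv\<^bsub>?P\<^esub> \<alpha> \<in> autotopies n X C"
    using P.inv_closed[OF \<alpha>] unfolding autotopies_def by blast
  fix \<beta> assume "\<beta> \<in> autotopies n X C"
  then have \<beta>: "\<beta> \<in> carrier ?P" and \<beta>S: "relabel n \<beta> ` ?S = ?S"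
    unfolding autotopies_def by blast+
  have "relabel n (\<alpha> \<otimes>\<^bsub>?P\<^esub> \<beta>) ` ?S = ?S"
    by (simp only: relabel_mult[OF \<alpha> \<beta> S] \<alpha>S \<beta>S)
  then show "\<alpha> \<otimes>\<^bsub>?P\<^esub> \<beta> \<in> autotopies n X C"
    using P.m_closed[OF \<alpha> \<beta>] unfolding autotopies_def by blast
qed

text \<open>
  The labellings of the coordinates are chosen separately, but translation by \<open>g\<close> amounts in each of
  them to the action of the same autotopy \<open>inv g\<close>. This is why the relabelled cube is invariant under
  simultaneous translation of all coordinates.
\<close>

theorem proposition3p7:
  fixes n v k l :: nat
    and X :: "'a set"
    and C :: "(nat \<Rightarrow> 'a) \<Rightarrow> 'f::field_char_0"
    and G :: "(nat \<Rightarrow> 'a \<Rightarrow> 'a) set"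
  assumes "n \<ge> 2"
    and "v \<ge> 1"
    and "projection_cube n X v k l C"
    and "subgroup G (Atop n X C)"
    and "sharply_transitive_on_coordinates n X G"
  shows "\<exists>D. difference_set_dim n ((Atop n X C)\<lparr>carrier := G\<rparr>) v k l D \<and>
             equivalent_cubes n X (cube_set n X C)
               G (development n ((Atop n X C)\<lparr>carrier := G\<rparr>) D)"
proof -
  define H where "H = (Atop n X C)\<lparr>carrier := G\<rparr>"
  let ?P = "bij_tuples n X" and ?S = "cube_set n X C"
  interpret H: group H
    unfolding H_def by (rule group.subgroup_imp_group[OF group_Atop assms(4)])
  have carH [simp]: "carrier H = G" by (simp add: H_def)
  have multH: "\<alpha> \<otimes>\<^bsub>H\<^esub> \<beta> = \<alpha> \<otimes>\<^bsub>?P\<^esub> \<beta>" for \<alpha> \<beta> by (simp add: H_def Atop_def)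
  have "G \<subseteq> autotopies n X C" using subgroup.subset[OF assms(4)] by (simp add: Atop_def)
  then have GP: "\<alpha> \<in> carrier ?P" and GS: "relabel n \<alpha> ` ?S = ?S" if "\<alpha> \<in> G" for \<alpha>
    using that unfolding autotopies_def by blast+
  have S: "?S \<subseteq> tuples n X" by (auto simp: cube_set_def)
  have X: "finite X" "card X = v" using assms(3) by (auto simp: projection_cube_def)
  then obtain p where p: "p \<in> X" using \<open>v \<ge> 1\<close> by fastforce
  have "\<exists>\<psi>. bij_betw \<psi> X G \<and> (\<forall>x\<in>X. \<forall>g\<in>G. \<psi> x \<otimes>\<^bsub>H\<^esub> g = \<psi> ((inv\<^bsub>H\<^esub> g) j x))"
    if j: "j \<in> {1..n}" for j
  proof (rule H.regular_action_as_right_translation[of X "\<lambda>\<alpha>. \<alpha> j" p])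
    show "\<alpha> j x \<in> X" if "\<alpha> \<in> carrier H" "x \<in> X" for \<alpha> x
      using bij_betwE[OF bij_tuples_bij[OF GP j]] that by simp
    show "(\<alpha> \<otimes>\<^bsub>H\<^esub> \<beta>) j x = \<alpha> j (\<beta> j x)"
      if "\<alpha> \<in> carrier H" "\<beta> \<in> carrier H" "x \<in> X" for \<alpha> \<beta> x
      unfolding multH using that by (intro bij_tuples_mult_apply GP j) simp_all
    show "\<exists>!\<alpha>. \<alpha> \<in> carrier H \<and> \<alpha> j p = x" if "x \<in> X" for x
      using assms(5) j p that by (simp add: sharply_transitive_on_coordinates_def)
  qed (use p in auto)
  then obtain \<psi> where bij: "\<And>j. j \<in> {1..n} \<Longrightarrow> bij_betw (\<psi> j) X G"
    and equivariant: "\<And>j x g. j \<in> {1..n} \<Longrightarrow> x \<in> X \<Longrightarrow> g \<in> G \<Longrightarrow>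
                        \<psi> j x \<otimes>\<^bsub>H\<^esub> g = \<psi> j ((inv\<^bsub>H\<^esub> g) j x)"
    by metis
  have "bij_betw (\<psi> 1) X G" using bij assms(1) by simp
  then have finG: "finite G" and "card G = v"
    using X by (auto simp: bij_betw_finite bij_betw_same_card)
  then have order: "order H = v" by (simp add: order_def)
  define T where "T = relabel n \<psi> ` ?S"
  have T: "projects_to_designs n (carrier H) k l T"
    unfolding T_def carH
    by (rule projects_to_designs_relabel[OF projection_cube_projects_to_designs[OF assms(3)] bij])
  have transl: "(\<lambda>j\<in>{1..n}. t j \<otimes>\<^bsub>H\<^esub> g) \<in> T" if t: "t \<in> T" and g: "g \<in> carrier H" for t g
  proof -
    obtain i where i: "i \<in> ?S" and t_eq: "t = relabel n \<psi> i" using t by (auto simp: T_def)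
    let ?\<beta> = "inv\<^bsub>H\<^esub> g"
    have "?\<beta> \<in> G" using H.inv_closed[OF g] by simp
    then have "relabel n ?\<beta> i \<in> ?S" using GS i by blast
    moreover have "(\<lambda>j\<in>{1..n}. t j \<otimes>\<^bsub>H\<^esub> g) = relabel n \<psi> (relabel n ?\<beta> i)"
    proof (rule restrict_ext)
      fix j assume j: "j \<in> {1..n}"
      then have "i j \<in> X" using i S by (auto simp: PiE_iff)
      then show "t j \<otimes>\<^bsub>H\<^esub> g = \<psi> j (relabel n ?\<beta> i j)"
        using j g equivariant by (simp add: t_eq)
    qed
    ultimately show ?thesis unfolding T_def by blast
  qed
  define D where "D = {t \<in> T. t 1 = \<one>\<^bsub>H\<^esub>}"
  have Tsub: "T \<subseteq> tuples n G" using T by (simp add: projects_to_designs_def)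
  have "difference_set_dim n H v k l D"
    unfolding D_def order[symmetric]
    using \<open>n \<ge> 2\<close> finG T transl by (intro H.slice_is_difference_set_dim) auto
  moreover have "development n H D = T"
    unfolding D_def using \<open>n \<ge> 2\<close> Tsub transl by (intro H.development_of_slice) auto
  moreover have "equivalent_cubes n X ?S G T"
    unfolding equivalent_cubes_def
  proof (intro conjI exI)
    show "id permutes {1..n}" by (rule permutes_id)
    show "\<forall>j\<in>{1..n}. bij_betw (\<psi> j) X G" using bij by blast
    show "(\<lambda>i. \<lambda>j\<in>{1..n}. \<psi> j (i (id j))) ` ?S = T" by (simp add: T_def)
  qed (fact S Tsub)+
  ultimately show ?thesis unfolding H_def by blast
qed

end
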